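(* Every tensor $A\in\mathbb{E}\mathrm{la}_6$ admits the following uniquely defined decomposition (the Clebsch-Gordan Harmonic Decomposition associated to the family of projectors $(P^{(3,3)},P^{(3,1s)},P^{(3,1r)})$): there is a unique family consisting of $H^{3,3}\in\mathbb{K}^6$, $(H^{3,1s},H^{3,1r})\in(\mathbb{K}^4)^2$, $(h^{3,1s},h^{3,1r},h^{1s,1r},h^{1s,1s},h^{1r,1r})\in(\mathbb{K}^2)^5$, $(\alpha^{3,3},\alpha^{1s,1s},\alpha^{1r,1r},\alpha^{1s,1r})\in(\mathbb{K}^0)^4$ and $\beta^{1s,1r}\in\mathbb{K}^{-1}$ such that, with $h^{1r,1s}:=h^{1s,1r}$, $$\begin{aligned} A={}&H^{3,3}+\tfrac43\left(H^{3,1s}\cdot\Phi^{s\{1,3\}}+\Phi^{s\{3,1\}}\cdot H^{3,1s}\right)+\tfrac32\left(H^{3,1r}\cdot\Phi^{r\{1,3\}}+\Phi^{r\{3,1\}}\cdot H^{3,1r}\right)\\ &+\tfrac{16}{9}\Phi^{s\{3,1\}}\cdot h^{1s,1s}\cdot\Phi^{s\{1,3\}}+\tfrac94\Phi^{r\{3,1\}}\cdot h^{1r,1r}\cdot\Phi^{r\{1,3\}}\\ &+\tfrac43\left((\Phi^{\{4,2\}}:h^{3,1s})\cdot\Phi^{s\{1,3\}}+\Phi^{s\{3,1\}}\cdot(\Phi^{\{4,2\}}:h^{3,1s})^{T_{3,1}}\right)\\ &+\tfrac32\left((\Phi^{\{4,2\}}:h^{3,1r})\cdot\Phi^{r\{1,3\}}+\Phi^{r\{3,1\}}\cdot(\Phi^{\{4,2\}}:h^{3,1r})^{T_{3,1}}\right)\\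 &+2\left(\Phi^{s\{3,1\}}\cdot h^{1s,1r}\cdot\Phi^{r\{1,3\}}+\Phi^{r\{3,1\}}\cdot h^{1r,1s}\cdot\Phi^{s\{1,3\}}\right)\\ &+\tfrac{\alpha^{3,3}}{2}P^{(3,3)}+\tfrac23\alpha^{1s,1s}P^{(3,1s)}+\tfrac34\alpha^{1r,1r}P^{(3,1r)}+\alpha^{1s,1r}\left(\Phi^{s\{3,1\}}\cdot\Phi^{r\{1,3\}}+\Phi^{r\{3,1\}}\cdot\Phi^{s\{1,3\}}\right)\\ &+\beta^{1s,1r}\left(\Phi^{s\{3,1\}}\cdot\epsilon\cdot\Phi^{r\{1,3\}}-\Phi^{r\{3,1\}}\cdot\epsilon\cdot\Phi^{s\{1,3\}}\right). \end{aligned}$$ These elements are obtained from $A$ as follows: - $\beta^{1s,1r}=a^{1s,1r}:\epsilon$; - $\alpha^{1s,1r}=a^{1s,1r}:\mathrm{i}^{(2)}$, $\alpha^{1r,1r}=a^{1r,1r}:\mathrm{i}^{(2)}$, $\alpha^{1s,1s}=a^{1s,1s}:\mathrm{i}^{(2)}$, $\alpha^{3,3}=A^{3,3}\overset{(6)}{\cdot}P^{(3,3)}$; - $h^{1s,1r}=a^{1s,1r}:P^{(2,2)}$, $h^{1r,1r}=a^{1r,1r}:P^{(2,2)}$, $h^{1s,1s}=a^{1s,1s}:P^{(2,2)}$, $h^{3,1r}=\mathrm{tr}_{14}(a^{3,1r})$, $h^{3,1s}=\mathrm{tr}_{14}(a^{3,1s})$; - $H^{3,1r}=a^{3,1r}-\Phi^{\{4,2\}}:h^{3,1r}$,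 $H^{3,1s}=a^{3,1s}-\Phi^{\{4,2\}}:h^{3,1s}$; - $H^{3,3}=A^{3,3}-\tfrac{\alpha^{3,3}}{2}P^{(3,3)}$, where $A^{3,3}:=P^{(3,3)}\vdots A\vdots P^{(3,3)}$, $a^{3,1s}:=P^{(3,3)}\vdots A\vdots\Phi^{s\{3,1\}}$, $a^{3,1r}:=P^{(3,3)}\vdots A\vdots\Phi^{r\{3,1\}}$, $a^{1s,1s}:=\Phi^{s\{1,3\}}\vdots A\vdots\Phi^{s\{3,1\}}$, $a^{1s,1r}:=\Phi^{s\{1,3\}}\vdots A\vdots\Phi^{r\{3,1\}}$, $a^{1r,1r}:=\Phi^{r\{1,3\}}\vdots A\vdots\Phi^{r\{3,1\}}$.
   Context: Tensors are real tensors on $\mathbb{R}^2$ with its standard Euclidean structure, identified with their component arrays in an orthonormal basis (indices in $\{1,2\}$, summation over repeated indices, $\delta_{ij}$ the Kronecker delta). $\mathbb{K}^n$ for $n\ge1$ is the space of totally symmetric traceless tensors of order $n$ (dimension 2); $\mathbb{K}^0=\mathbb{R}$ (scalars); $\mathbb{K}^{-1}$ is the line of pseudo-scalars ($\mathbb{R}$ with $g\in\mathrm{O}(2)$ acting by $\det g$). Contractions: $X\cdot Y$, $X:Y$, $X\vdots Y$, $X\overset{(r)}{\cdot}Y$ contract, respectively, the last $1,2,3,r$ indices of $X$ with the first $1,2,3,r$ indices of $Y$, in the same order: $(X\overset{(r)}{\cdot}Y)_{i\ldots j\ldots}=X_{i\ldots p_1\ldots p_r}Y_{p_1\ldots p_r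 j\ldots}$. $\mathrm{tr}_{14}$ is the contraction of the 1st and 4th indices. $\mathrm{i}^{(2)}$ has components $\delta_{ij}$; $\epsilon$ is the 2D Levi-Civita tensor ($\epsilon_{12}=1$, $\epsilon_{21}=-1$, $\epsilon_{11}=\epsilon_{22}=0$). $\mathbb{T}_{(ij)k}$ is the space of third-order tensors with $T_{ijk}=T_{jik}$. $\mathbb{E}\mathrm{la}_6$ is the space of sixth-order tensors $A_{ijklmn}$ symmetric under $i\leftrightarrow j$, under $l\leftrightarrow m$, and under exchange of the blocks $(ijk)\leftrightarrow(lmn)$. $P^{(2,2)}_{ijkl}=\frac12(\delta_{ik}\delta_{jl}+\delta_{il}\delta_{jk}-\delta_{ij}\delta_{kl})$. $\Phi^{s\{3,1\}}_{ijkl}=\frac14(\delta_{ij}\delta_{kl}+\delta_{ik}\delta_{jl}+\delta_{il}\delta_{jk})$ and $\Phi^{r\{3,1\}}_{ijkl}=\frac13(2\delta_{ij}\delta_{kl}-\delta_{ik}\delta_{jl}-\delta_{il}\delta_{jk})$; their transposes are $(\Phi^{s\{1,3\}})_{lijk}=\Phi^{s\{3,1\}}_{ijkl}$, $(\Phi^{r\{1,3\}})_{lijk}=\Phi^{r\{3,1\}}_{ijkl}$. $I_{ijklmn}=\frac12(\delta_{il}\delta_{jm}\delta_{kn}+\delta_{im}\delta_{jl}\delta_{kn})$ is the identity on $\mathbb{T}_{(ij)k}$; $P^{(3,1r)}=\frac32\Phi^{r\{3,1\}}\cdot\Phi^{r\{1,3\}}$, $P^{(3,1s)}=\frac43\Phi^{s\{3,1\}}\cdot\Phi^{s\{1,3\}}$,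 $P^{(3,3)}=I-P^{(3,1s)}-P^{(3,1r)}$. For $h\in\mathbb{K}^2$, $(\Phi^{\{4,2\}}:h)_{ijkl}=\frac12(h_{ij}\delta_{kl}+h_{ik}\delta_{jl}-h_{il}\delta_{jk})$. For a fourth-order tensor $X$, $X^{T_{3,1}}$ is the tensor obtained by exchanging the first three indices with the last one: $(X^{T_{3,1}})_{lijk}=X_{ijkl}$. *)

theory Defs
  imports "HOL-Analysis.Analysis"
begin

(* A tensor of order n on R^2 is its array of components T $ i1 $ ... $ in in an orthonormal
   basis.  The index type 2 has exactly the elements 1 and 2 (with 2 = 0 in type 2). *)

type_synonym tensor2 = "real^2^2"
type_synonym tensor4 = "real^2^2^2^2"
type_synonym tensor6 = "real^2^2^2^2^2^2"

definition kdelta :: "2 \<Rightarrow> 2 \<Rightarrow> real" ("\<delta>") where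
  "\<delta> i j = (if i = j then 1 else 0)"

(* The contractions are polymorphic in the remaining indices of the right factor: 'a is real,
   real^2, ... according to its order.  The order of the left factor is fixed by the type; the
   triple contraction is needed with left factors of order 4 and of order 6. *)

definition contr1 :: "tensor4 \<Rightarrow> 'a::real_vector^2 \<Rightarrow> 'a^2^2^2" (infixl "\<cdot>\<^sub>1" 76) where
  "X \<cdot>\<^sub>1 Y = (\<chi> i j k. \<Sum>p\<in>UNIV. X $ i $ j $ k $ p *\<^sub>R Y $ p)"

definition contr2 :: "tensor2 \<Rightarrow> 'a::real_vector^2^2 \<Rightarrow> 'a" (infixl "\<cdot>\<^sub>2" 76) where
  "X \<cdot>\<^sub>2 Y = (\<Sum>p\<in>UNIV. \<Sum>q\<in>UNIV. X $ p $ q *\<^sub>R Y $ p $ q)"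

definition contr3_4 :: "tensor4 \<Rightarrow> 'a::real_vector^2^2^2 \<Rightarrow> 'a^2"
    (infixl "\<cdot>\<^sub>3\<^sub>,\<^sub>4" 76) where
  "X \<cdot>\<^sub>3\<^sub>,\<^sub>4 Y = (\<chi> i. \<Sum>p\<in>UNIV. \<Sum>q\<in>UNIV. \<Sum>r\<in>UNIV. X $ i $ p $ q $ r *\<^sub>R Y $ p $ q $ r)"

definition contr3_6 :: "tensor6 \<Rightarrow> 'a::real_vector^2^2^2 \<Rightarrow> 'a^2^2^2"
    (infixl "\<cdot>\<^sub>3\<^sub>,\<^sub>6" 76) where
  "X \<cdot>\<^sub>3\<^sub>,\<^sub>6 Y = (\<chi> i j k. \<Sum>p\<in>UNIV. \<Sum>q\<in>UNIV. \<Sum>r\<in>UNIV.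
     X $ i $ j $ k $ p $ q $ r *\<^sub>R Y $ p $ q $ r)"

definition contr6 :: "tensor6 \<Rightarrow> tensor6 \<Rightarrow> real" (infixl "\<cdot>\<^sub>6" 76) where
  "X \<cdot>\<^sub>6 Y = (\<Sum>i\<in>UNIV. \<Sum>j\<in>UNIV. \<Sum>k\<in>UNIV. \<Sum>l\<in>UNIV. \<Sum>m\<in>UNIV. \<Sum>n\<in>UNIV.
     X $ i $ j $ k $ l $ m $ n * Y $ i $ j $ k $ l $ m $ n)"

definition tr14 :: "tensor4 \<Rightarrow> tensor2" where
  "tr14 X = (\<chi> j k. \<Sum>p\<in>UNIV. X $ p $ j $ k $ p)"

definition transp31 :: "tensor4 \<Rightarrow> tensor4" where
  "transp31 X = (\<chi> l i j k. X $ i $ j $ k $ l)"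

(* To treat all orders at once, the array of a tensor of order n is viewed below as a function c
   of multi-indices f, where f 0, ..., f (n - 1) are the n indices. *)

definition totally_symmetric :: "nat \<Rightarrow> ((nat \<Rightarrow> 2) \<Rightarrow> real) \<Rightarrow> bool" where
  "totally_symmetric n c \<longleftrightarrow> (\<forall>\<pi>. \<pi> permutes {..<n} \<longrightarrow> (\<forall>f. c (f \<circ> \<pi>) = c f))"

definition traceless :: "nat \<Rightarrow> ((nat \<Rightarrow> 2) \<Rightarrow> real) \<Rightarrow> bool" where
  "traceless n c \<longleftrightarrow>
     (\<forall>a b f. a < b \<and> b < n \<longrightarrow> (\<Sum>p\<in>UNIV. c (f(a := p, b := p))) = 0)"

definition K2 :: "tensor2 set" where
  "K2 = {h. let c = (\<lambda>f. h $ f 0 $ f 1) in totally_symmetric 2 c \<and> traceless 2 c}"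

definition K4 :: "tensor4 set" where
  "K4 = {H. let c = (\<lambda>f. H $ f 0 $ f 1 $ f 2 $ f 3) in totally_symmetric 4 c \<and> traceless 4 c}"

definition K6 :: "tensor6 set" where
  "K6 = {H. let c = (\<lambda>f. H $ f 0 $ f 1 $ f 2 $ f 3 $ f 4 $ f 5)
            in totally_symmetric 6 c \<and> traceless 6 c}"

definition Ela6 :: "tensor6 set" where
  "Ela6 = {A. \<forall>i j k l m n.
      A $ i $ j $ k $ l $ m $ n = A $ j $ i $ k $ l $ m $ n \<and>
      A $ i $ j $ k $ l $ m $ n = A $ i $ j $ k $ m $ l $ n \<and>
      A $ i $ j $ k $ l $ m $ n = A $ l $ m $ n $ i $ j $ k}"

definition id2 :: tensor2 where
  "id2 = (\<chi> i j. \<delta> i j)"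

definition levi_civita :: tensor2 ("\<epsilon>") where
  "\<epsilon> = (\<chi> i j. if i = 1 \<and> j = 2 then 1 else if i = 2 \<and> j = 1 then - 1 else 0)"

definition P22 :: tensor4 where
  "P22 = (\<chi> i j k l. 1/2 * (\<delta> i k * \<delta> j l + \<delta> i l * \<delta> j k - \<delta> i j * \<delta> k l))"

definition Phi_s31 :: tensor4 ("\<Phi>s31") where
  "\<Phi>s31 = (\<chi> i j k l. 1/4 * (\<delta> i j * \<delta> k l + \<delta> i k * \<delta> j l + \<delta> i l * \<delta> j k))"

definition Phi_r31 :: tensor4 ("\<Phi>r31") where
  "\<Phi>r31 = (\<chi> i j k l. 1/3 * (2 * \<delta> i j * \<delta> k l - \<delta> i k * \<delta> j l - \<delta> i l * \<delta> j k))"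

definition Phi_s13 :: tensor4 ("\<Phi>s13") where
  "\<Phi>s13 = transp31 \<Phi>s31"

definition Phi_r13 :: tensor4 ("\<Phi>r13") where
  "\<Phi>r13 = transp31 \<Phi>r31"

definition Id6 :: tensor6 where
  "Id6 = (\<chi> i j k l m n. 1/2 * (\<delta> i l * \<delta> j m * \<delta> k n + \<delta> i m * \<delta> j l * \<delta> k n))"

definition P31r :: tensor6 where
  "P31r = (3/2) *\<^sub>R (\<Phi>r31 \<cdot>\<^sub>1 \<Phi>r13)"

definition P31s :: tensor6 where
  "P31s = (4/3) *\<^sub>R (\<Phi>s31 \<cdot>\<^sub>1 \<Phi>s13)"

definition P33 :: tensor6 where
  "P33 = Id6 - P31s - P31r"

(* The tensor obtained by contracting the embedding of order 6 with h; only used for h in K2. *)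
definition Phi42 :: "tensor2 \<Rightarrow> tensor4" ("\<Phi>42") where
  "\<Phi>42 h = (\<chi> i j k l. 1/2 * (h $ i $ j * \<delta> k l + h $ i $ k * \<delta> j l - h $ i $ l * \<delta> j k))"

definition A33 :: "tensor6 \<Rightarrow> tensor6" where
  "A33 A = P33 \<cdot>\<^sub>3\<^sub>,\<^sub>6 A \<cdot>\<^sub>3\<^sub>,\<^sub>6 P33"

definition a31s :: "tensor6 \<Rightarrow> tensor4" where
  "a31s A = P33 \<cdot>\<^sub>3\<^sub>,\<^sub>6 A \<cdot>\<^sub>3\<^sub>,\<^sub>6 \<Phi>s31"

definition a31r :: "tensor6 \<Rightarrow> tensor4" where
  "a31r A = P33 \<cdot>\<^sub>3\<^sub>,\<^sub>6 A \<cdot>\<^sub>3\<^sub>,\<^sub>6 \<Phi>r31"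

definition a1s1s :: "tensor6 \<Rightarrow> tensor2" where
  "a1s1s A = \<Phi>s13 \<cdot>\<^sub>3\<^sub>,\<^sub>4 A \<cdot>\<^sub>3\<^sub>,\<^sub>4 \<Phi>s31"

definition a1s1r :: "tensor6 \<Rightarrow> tensor2" where
  "a1s1r A = \<Phi>s13 \<cdot>\<^sub>3\<^sub>,\<^sub>4 A \<cdot>\<^sub>3\<^sub>,\<^sub>4 \<Phi>r31"

definition a1r1r :: "tensor6 \<Rightarrow> tensor2" where
  "a1r1r A = \<Phi>r13 \<cdot>\<^sub>3\<^sub>,\<^sub>4 A \<cdot>\<^sub>3\<^sub>,\<^sub>4 \<Phi>r31"

(* The family is a Clebsch-Gordan Harmonic Decomposition of A associated to (P33, P31s, P31r).
   The scalars \<alpha> and the pseudo-scalar \<beta> are plain reals: in a fixed orthonormal basis the spaces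
   K^0 and K^(-1) are both the real line and differ only by the action of O(2). *)
definition is_CGHD ::
  "tensor6 \<Rightarrow> tensor6 \<Rightarrow> tensor4 \<Rightarrow> tensor4 \<Rightarrow>
   tensor2 \<Rightarrow> tensor2 \<Rightarrow> tensor2 \<Rightarrow> tensor2 \<Rightarrow> tensor2 \<Rightarrow>
   real \<Rightarrow> real \<Rightarrow> real \<Rightarrow> real \<Rightarrow> real \<Rightarrow> bool" where
  "is_CGHD A H33 H31s H31r h31s h31r h1s1r h1s1s h1r1r \<alpha>33 \<alpha>1s1s \<alpha>1r1r \<alpha>1s1r \<beta>1s1r \<longleftrightarrow>
     H33 \<in> K6 \<and> H31s \<in> K4 \<and> H31r \<in> K4 \<and>
     h31s \<in> K2 \<and> h31r \<in> K2 \<and> h1s1r \<in> K2 \<and> h1s1s \<in> K2 \<and> h1r1r \<in> K2 \<and>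
     (let h1r1s = h1s1r in
      A = H33
        + (4/3) *\<^sub>R (H31s \<cdot>\<^sub>1 \<Phi>s13 + \<Phi>s31 \<cdot>\<^sub>1 H31s)
        + (3/2) *\<^sub>R (H31r \<cdot>\<^sub>1 \<Phi>r13 + \<Phi>r31 \<cdot>\<^sub>1 H31r)
        + (16/9) *\<^sub>R (\<Phi>s31 \<cdot>\<^sub>1 h1s1s \<cdot>\<^sub>1 \<Phi>s13)
        + (9/4) *\<^sub>R (\<Phi>r31 \<cdot>\<^sub>1 h1r1r \<cdot>\<^sub>1 \<Phi>r13)
        + (4/3) *\<^sub>R (\<Phi>42 h31s \<cdot>\<^sub>1 \<Phi>s13 + \<Phi>s31 \<cdot>\<^sub>1 transp31 (\<Phi>42 h31s))
        + (3/2) *\<^sub>R (\<Phi>42 h31r \<cdot>\<^sub>1 \<Phi>r13 + \<Phi>r31 \<cdot>\<^sub>1 transp31 (\<Phi>42 h31r))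
        + 2 *\<^sub>R (\<Phi>s31 \<cdot>\<^sub>1 h1s1r \<cdot>\<^sub>1 \<Phi>r13 + \<Phi>r31 \<cdot>\<^sub>1 h1r1s \<cdot>\<^sub>1 \<Phi>s13)
        + (\<alpha>33 / 2) *\<^sub>R P33
        + (2/3 * \<alpha>1s1s) *\<^sub>R P31s
        + (3/4 * \<alpha>1r1r) *\<^sub>R P31r
        + \<alpha>1s1r *\<^sub>R (\<Phi>s31 \<cdot>\<^sub>1 \<Phi>r13 + \<Phi>r31 \<cdot>\<^sub>1 \<Phi>s13)
        + \<beta>1s1r *\<^sub>R (\<Phi>s31 \<cdot>\<^sub>1 \<epsilon> \<cdot>\<^sub>1 \<Phi>r13 - \<Phi>r31 \<cdot>\<^sub>1 \<epsilon> \<cdot>\<^sub>1 \<Phi>s13))"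

end

theory Submission
  imports Defs
begin

text \<open>
  The projectors \<open>P33\<close>, \<open>P31s\<close>, \<open>P31r\<close> sum to the identity on third-order tensors symmetric in the
  first two indices, so \<open>A\<close> is the sum of its nine blocks \<open>P \<cdot> A \<cdot> Q\<close>.  Since \<open>P31s\<close> and \<open>P31r\<close>
  factor through vectors by \<open>\<Phi>s\<close> and \<open>\<Phi>r\<close>, and blocks off the diagonal are paired by the symmetry of
  \<open>A\<close>, the blocks amount to \<open>A33\<close>, \<open>a31s\<close>, \<open>a31r\<close>, \<open>a1s1s\<close>, \<open>a1s1r\<close>, \<open>a1r1r\<close>, each of which splits
  into its harmonic parts.  Conversely, the relations \<open>\<Phi>s13 \<cdot> \<Phi>s31 = 3/4 id\<close>, \<open>\<Phi>r13 \<cdot> \<Phi>r31 = 2/3 id\<close>,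
  \<open>\<Phi>s13 \<cdot> \<Phi>r31 = 0\<close> and \<open>P33 \<cdot> \<Phi> = 0\<close> recover these six blocks, and then their harmonic parts, from any
  decomposition of \<open>A\<close>, which gives uniqueness.
\<close>

section \<open>Harmonic tensors in the plane\<close>

text \<open>In a symmetric traceless array two indices 2 may be replaced by two indices 1 at the cost of
  a sign.  So a component depends only on the number \<open>m\<close> of indices 2, and \<open>x\<close>, \<open>y\<close> are the components
  with \<open>m = 0\<close> and \<open>m = 1\<close>.\<close>

definition harmonic :: "'a::real_vector \<Rightarrow> 'a \<Rightarrow> nat \<Rightarrow> 'a" where
  "harmonic x y m = (- 1) ^ (m div 2) *\<^sub>R (if even m then x else y)"

definition twos :: "2 \<Rightarrow> nat" where
  "twos i = (if i = 2 then 1 else 0)"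

lemma harmonic_simps [simp]:
  "harmonic x y 0 = x" "harmonic x y (Suc 0) = y" "harmonic x y (Suc (Suc m)) = - harmonic x y m"
  by (simp_all add: harmonic_def)

lemma harmonic_nth: "harmonic x y m $ i = harmonic (x $ i) (y $ i) m"
  by (simp add: harmonic_def)

lemma twos_simps [simp]: "twos 1 = 0" "twos 2 = Suc 0"
  by (simp_all add: twos_def)

lemma sum_twos_eq_card:
  "(\<Sum>k<n. twos (f k)) = card {k::nat. k < n \<and> f k = 2}"
proof -
  have "(\<Sum>k<n. twos (f k)) = (\<Sum>k\<in>{k \<in> {..<n}. f k = 2}. 1)"
    unfolding twos_def by (rule sum.inter_filter[symmetric]) simp
  then show ?thesis by simp
qed

text \<open>Induction on the number of indices 2: with at most one of them, symmetry leads to a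
  reference component; with two, a vanishing trace trades them for indices 1 with a sign.
  Multi-indices are functions on all naturals, so \<open>dep\<close> confines \<open>c\<close> to
  the first \<open>n\<close> values.\<close>

lemma harmonic_array_iff:
  fixes c :: "(nat \<Rightarrow> 2) \<Rightarrow> real"
  assumes "n > 0" and dep: "\<And>f g. (\<And>k. k < n \<Longrightarrow> f k = g k) \<Longrightarrow> c f = c g"
  shows "totally_symmetric n c \<and> traceless n c \<longleftrightarrow> (\<exists>x y. \<forall>f. c f = harmonic x y (\<Sum>k<n. twos (f k)))"
proof
  assume *: "totally_symmetric n c \<and> traceless n c"
  have "c f = harmonic (c (\<lambda>_. 1)) (c ((\<lambda>_. 1)(0 := 2))) (card {k. k < n \<and> f k = 2})" for f
  proof (induction "card {k. k < n \<and> f k = 2}" arbitrary: f rule: less_induct)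
    case less
    let ?S = "{k. k < n \<and> f k = 2}"
    have not_2: "f k = 1" if "f k \<noteq> 2" for k
      using that exhaust_2 by blast
    consider "card ?S = 0" | "card ?S = Suc 0" | "card ?S \<ge> 2" by linarith
    then show ?case
    proof cases
      case 1
      then have "f k = 1" if "k < n" for k using that not_2[of k] by auto
      then have "c f = c (\<lambda>_. 1)" by (intro dep) auto
      then show ?thesis by (simp only: 1 harmonic_simps)
    next
      case 2
      then obtain a where a: "?S = {a}" by (auto simp: card_1_singleton_iff)
      then have "a < n" "f a = 2" by auto
      have "f k = 1" if "k < n" "k \<noteq> a" for k using a that not_2[of k] by auto
      \<comment> \<open>The swap of \<open>0\<close> and \<open>a\<close> carries the single index 2
        to position 0, giving the reference multi-index for the second parameter.\<close>
      then have "f k = (((\<lambda>_. 1)(0 := 2)) \<circ> Transposition.transpose 0 a) k" if "k < n" for k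
        using that \<open>f a = 2\<close> by (cases "k = a"; cases "k = 0") auto
      then have "c f = c (((\<lambda>_. 1)(0 := 2)) \<circ> Transposition.transpose 0 a)"
        by (rule dep)
      also have "\<dots> = c ((\<lambda>_. 1)(0 := 2))"
        using * \<open>n > 0\<close> \<open>a < n\<close> permutes_swap_id[of 0 "{..<n}" a]
        unfolding totally_symmetric_def by blast
      finally show ?thesis using 2 by simp
    next
      case 3
      then obtain T where "T \<subseteq> ?S" "card T = 2"
        by (rule obtain_subset_with_card_n)
      then obtain a' b' where "{a', b'} \<subseteq> ?S" "a' \<noteq> b'"
        by (auto simp: card_2_iff)
      then obtain a b where ab: "a \<in> ?S" "b \<in> ?S" "a < b"
        by (cases a' b' rule: linorder_cases) auto
      \<comment> \<open>The trace over positions \<open>a\<close> and \<open>b\<close> reads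
        \<open>c g + c f = 0\<close>, and the count of indices 2 drops by two, which matches the
        sign rule for \<open>harmonic\<close>.\<close>
      define g where "g = f(a := 1, b := 1)"
      have "?S = insert a (insert b {k. k < n \<and> g k = 2})"
        using ab by (auto simp: g_def)
      moreover have "card (insert a (insert b {k. k < n \<and> g k = 2})) =
          Suc (Suc (card {k. k < n \<and> g k = 2}))"
        using ab by (simp add: g_def)
      ultimately have card: "card ?S = Suc (Suc (card {k. k < n \<and> g k = 2}))" by simp
      have "(\<Sum>p\<in>UNIV. c (f(a := p, b := p))) = 0"
        using * ab unfolding traceless_def by blast
      moreover have "f(a := 2, b := 2) = f" using ab by auto
      ultimately have "c f = - c g" by (simp add: sum_2 g_def)
      then show ?thesis using less[of g] card by simp
    qed
  qed
  then show "\<exists>x y. \<forall>f. c f = harmonic x y (\<Sum>k<n. twos (f k))"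
    unfolding sum_twos_eq_card by blast
next
  assume "\<exists>x y. \<forall>f. c f = harmonic x y (\<Sum>k<n. twos (f k))"
  then obtain x y where c: "\<And>f. c f = harmonic x y (\<Sum>k<n. twos (f k))" by blast
  have "(\<Sum>k<n. twos ((f \<circ> \<pi>) k)) = (\<Sum>k<n. twos (f k))" if "\<pi> permutes {..<n}" for f \<pi>
    using sum.permute[OF that, of "\<lambda>k. twos (f k)"] by (simp add: comp_def)
  moreover have "(\<Sum>p\<in>UNIV. c (f(a := p, b := p))) = 0" if "a < b" "b < n" for a b f
  proof -
    \<comment> \<open>Setting both positions to \<open>p\<close> adds 0 or 2 to the count, so the
      two terms of the trace are opposite.\<close>
    have "(\<Sum>k<n. twos ((f(a := p, b := p)) k)) =
        twos p + twos p + (\<Sum>k\<in>{..<n} - {a} - {b}. twos (f k))" for p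
      using that by (simp add: sum.remove[of "{..<n}" a] sum.remove[of "{..<n} - {a}" b])
    then show ?thesis by (simp add: c sum_2)
  qed
  ultimately show "totally_symmetric n c \<and> traceless n c"
    by (simp add: totally_symmetric_def traceless_def c)
qed

lemma K2_iff: "h \<in> K2 \<longleftrightarrow> (\<exists>x y. \<forall>i j. h $ i $ j = harmonic x y (twos i + twos j))"
proof -
  have "h \<in> K2 \<longleftrightarrow> (\<exists>x y. \<forall>f :: nat \<Rightarrow> 2. h $ f 0 $ f 1 = harmonic x y (\<Sum>k<2. twos (f k)))"
    unfolding K2_def mem_Collect_eq Let_def by (subst harmonic_array_iff) simp_all
  also have "\<dots> \<longleftrightarrow> (\<exists>x y. \<forall>i j. h $ i $ j = harmonic x y (twos i + twos j))"
  proof (intro iff_exI iffI allI)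
    fix x y :: real and i j :: 2
    assume "\<forall>f :: nat \<Rightarrow> 2. h $ f 0 $ f 1 = harmonic x y (\<Sum>k<2. twos (f k))"
    \<comment> \<open>List indexing supplies a multi-index with prescribed leading entries.\<close>
    from spec[OF this, of "(!) [i, j]"]
    show "h $ i $ j = harmonic x y (twos i + twos j)" by (simp add: eval_nat_numeral)
  qed (simp add: eval_nat_numeral)
  finally show ?thesis .
qed

lemma K4_iff:
  "H \<in> K4 \<longleftrightarrow> (\<exists>x y. \<forall>i j k l. H $ i $ j $ k $ l = harmonic x y (twos i + twos j + twos k + twos l))"
proof -
  have "H \<in> K4 \<longleftrightarrow> (\<exists>x y. \<forall>f :: nat \<Rightarrow> 2. H $ f 0 $ f 1 $ f 2 $ f 3 = harmonic x y (\<Sum>k<4. twos (f k)))"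
    unfolding K4_def mem_Collect_eq Let_def by (subst harmonic_array_iff) simp_all
  also have "\<dots> \<longleftrightarrow>
      (\<exists>x y. \<forall>i j k l. H $ i $ j $ k $ l = harmonic x y (twos i + twos j + twos k + twos l))"
  proof (intro iff_exI iffI allI)
    fix x y :: real and i j k l :: 2
    assume "\<forall>f :: nat \<Rightarrow> 2. H $ f 0 $ f 1 $ f 2 $ f 3 = harmonic x y (\<Sum>k<4. twos (f k))"
    from spec[OF this, of "(!) [i, j, k, l]"]
    show "H $ i $ j $ k $ l = harmonic x y (twos i + twos j + twos k + twos l)"
      by (simp add: eval_nat_numeral)
  qed (simp add: eval_nat_numeral)
  finally show ?thesis .
qed

lemma K6_iff:
  "H \<in> K6 \<longleftrightarrow> (\<exists>x y. \<forall>i j k l m n. H $ i $ j $ k $ l $ m $ n =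
    harmonic x y (twos i + twos j + twos k + twos l + twos m + twos n))"
proof -
  have "H \<in> K6 \<longleftrightarrow>
      (\<exists>x y. \<forall>f :: nat \<Rightarrow> 2. H $ f 0 $ f 1 $ f 2 $ f 3 $ f 4 $ f 5 = harmonic x y (\<Sum>k<6. twos (f k)))"
    unfolding K6_def mem_Collect_eq Let_def by (subst harmonic_array_iff) simp_all
  also have "\<dots> \<longleftrightarrow> (\<exists>x y. \<forall>i j k l m n. H $ i $ j $ k $ l $ m $ n =
      harmonic x y (twos i + twos j + twos k + twos l + twos m + twos n))"
  proof (intro iff_exI iffI allI)
    fix x y :: real and i j k l m n :: 2
    assume "\<forall>f :: nat \<Rightarrow> 2. H $ f 0 $ f 1 $ f 2 $ f 3 $ f 4 $ f 5 = harmonic x y (\<Sum>k<6. twos (f k))"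
    from spec[OF this, of "(!) [i, j, k, l, m, n]"]
    show "H $ i $ j $ k $ l $ m $ n =
        harmonic x y (twos i + twos j + twos k + twos l + twos m + twos n)"
      by (simp add: eval_nat_numeral)
  qed (simp add: eval_nat_numeral)
  finally show ?thesis .
qed

section \<open>Calculus of contractions\<close>

text \<open>Every index takes only the values 1 and 2, so unfolding with these facts reduces a
  tensor identity to finitely many component equations.\<close>

lemmas components = vec_eq_iff forall_2 sum_2 kdelta_def

text \<open>Needed once \<open>X \<cdot>\<^sub>1 h \<cdot>\<^sub>1 Y\<close> is bracketed to the
  right, where the left factor \<open>h\<close> has order 2 instead of 4.\<close>

definition contr1_2 :: "tensor2 \<Rightarrow> 'a::real_vector^2 \<Rightarrow> 'a^2" (infixl "\<cdot>\<^sub>1\<^sub>,\<^sub>2" 76) where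
  "h \<cdot>\<^sub>1\<^sub>,\<^sub>2 Y = (\<chi> i. \<Sum>p\<in>UNIV. h $ i $ p *\<^sub>R Y $ p)"

lemma contr1_linear:
  "(X + X') \<cdot>\<^sub>1 Y = X \<cdot>\<^sub>1 Y + X' \<cdot>\<^sub>1 Y" "(X - X') \<cdot>\<^sub>1 Y = X \<cdot>\<^sub>1 Y - X' \<cdot>\<^sub>1 Y"
  "(c *\<^sub>R X) \<cdot>\<^sub>1 Y = c *\<^sub>R (X \<cdot>\<^sub>1 Y)" "0 \<cdot>\<^sub>1 Y = 0"
  "X \<cdot>\<^sub>1 (Z + Z') = X \<cdot>\<^sub>1 Z + X \<cdot>\<^sub>1 Z'" "X \<cdot>\<^sub>1 (Z - Z') = X \<cdot>\<^sub>1 Z - X \<cdot>\<^sub>1 Z'"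
  "X \<cdot>\<^sub>1 (c *\<^sub>R Z) = c *\<^sub>R (X \<cdot>\<^sub>1 Z)" "X \<cdot>\<^sub>1 0 = 0"
  by (simp_all add: contr1_def vec_eq_iff sum.distrib sum_subtractf scaleR_sum_right algebra_simps)

lemma contr1_2_linear:
  "(X + X') \<cdot>\<^sub>1\<^sub>,\<^sub>2 Y = X \<cdot>\<^sub>1\<^sub>,\<^sub>2 Y + X' \<cdot>\<^sub>1\<^sub>,\<^sub>2 Y" "(X - X') \<cdot>\<^sub>1\<^sub>,\<^sub>2 Y = X \<cdot>\<^sub>1\<^sub>,\<^sub>2 Y - X' \<cdot>\<^sub>1\<^sub>,\<^sub>2 Y"
  "(c *\<^sub>R X) \<cdot>\<^sub>1\<^sub>,\<^sub>2 Y = c *\<^sub>R (X \<cdot>\<^sub>1\<^sub>,\<^sub>2 Y)" "0 \<cdot>\<^sub>1\<^sub>,\<^sub>2 Y = 0" "X \<cdot>\<^sub>1\<^sub>,\<^sub>2 (c *\<^sub>R Z) = c *\<^sub>R (X \<cdot>\<^sub>1\<^sub>,\<^sub>2 Z)" "X \<cdot>\<^sub>1\<^sub>,\<^sub>2 0 = 0"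
  by (simp_all add: contr1_2_def vec_eq_iff sum.distrib sum_subtractf scaleR_sum_right algebra_simps)

lemma contr3_4_linear:
  "(X + X') \<cdot>\<^sub>3\<^sub>,\<^sub>4 Y = X \<cdot>\<^sub>3\<^sub>,\<^sub>4 Y + X' \<cdot>\<^sub>3\<^sub>,\<^sub>4 Y" "(X - X') \<cdot>\<^sub>3\<^sub>,\<^sub>4 Y = X \<cdot>\<^sub>3\<^sub>,\<^sub>4 Y - X' \<cdot>\<^sub>3\<^sub>,\<^sub>4 Y"
  "(c *\<^sub>R X) \<cdot>\<^sub>3\<^sub>,\<^sub>4 Y = c *\<^sub>R (X \<cdot>\<^sub>3\<^sub>,\<^sub>4 Y)" "0 \<cdot>\<^sub>3\<^sub>,\<^sub>4 Y = 0"
  "X \<cdot>\<^sub>3\<^sub>,\<^sub>4 (Z + Z') = X \<cdot>\<^sub>3\<^sub>,\<^sub>4 Z + X \<cdot>\<^sub>3\<^sub>,\<^sub>4 Z'" "X \<cdot>\<^sub>3\<^sub>,\<^sub>4 (Z - Z') = X \<cdot>\<^sub>3\<^sub>,\<^sub>4 Z - X \<cdot>\<^sub>3\<^sub>,\<^sub>4 Z'"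
  "X \<cdot>\<^sub>3\<^sub>,\<^sub>4 (c *\<^sub>R Z) = c *\<^sub>R (X \<cdot>\<^sub>3\<^sub>,\<^sub>4 Z)" "X \<cdot>\<^sub>3\<^sub>,\<^sub>4 0 = 0"
  by (simp_all add: contr3_4_def vec_eq_iff sum.distrib sum_subtractf scaleR_sum_right algebra_simps)

lemma contr3_6_linear:
  "(X + X') \<cdot>\<^sub>3\<^sub>,\<^sub>6 Y = X \<cdot>\<^sub>3\<^sub>,\<^sub>6 Y + X' \<cdot>\<^sub>3\<^sub>,\<^sub>6 Y" "(X - X') \<cdot>\<^sub>3\<^sub>,\<^sub>6 Y = X \<cdot>\<^sub>3\<^sub>,\<^sub>6 Y - X' \<cdot>\<^sub>3\<^sub>,\<^sub>6 Y"
  "(c *\<^sub>R X) \<cdot>\<^sub>3\<^sub>,\<^sub>6 Y = c *\<^sub>R (X \<cdot>\<^sub>3\<^sub>,\<^sub>6 Y)" "0 \<cdot>\<^sub>3\<^sub>,\<^sub>6 Y = 0"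
  "X \<cdot>\<^sub>3\<^sub>,\<^sub>6 (Z + Z') = X \<cdot>\<^sub>3\<^sub>,\<^sub>6 Z + X \<cdot>\<^sub>3\<^sub>,\<^sub>6 Z'" "X \<cdot>\<^sub>3\<^sub>,\<^sub>6 (Z - Z') = X \<cdot>\<^sub>3\<^sub>,\<^sub>6 Z - X \<cdot>\<^sub>3\<^sub>,\<^sub>6 Z'"
  "X \<cdot>\<^sub>3\<^sub>,\<^sub>6 (c *\<^sub>R Z) = c *\<^sub>R (X \<cdot>\<^sub>3\<^sub>,\<^sub>6 Z)" "X \<cdot>\<^sub>3\<^sub>,\<^sub>6 0 = 0"
  by (simp_all add: contr3_6_def vec_eq_iff sum.distrib sum_subtractf scaleR_sum_right algebra_simps)

lemma contr2_linear:
  "(X + X') \<cdot>\<^sub>2 Y = X \<cdot>\<^sub>2 Y + X' \<cdot>\<^sub>2 Y" "(X - X') \<cdot>\<^sub>2 Y = X \<cdot>\<^sub>2 Y - X' \<cdot>\<^sub>2 Y"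
  "(c *\<^sub>R X) \<cdot>\<^sub>2 Y = c *\<^sub>R (X \<cdot>\<^sub>2 Y)" "0 \<cdot>\<^sub>2 Y = 0"
  by (simp_all add: contr2_def sum.distrib sum_subtractf scaleR_sum_right algebra_simps)

lemma contr6_linear:
  "(X + X') \<cdot>\<^sub>6 Y = X \<cdot>\<^sub>6 Y + X' \<cdot>\<^sub>6 Y" "(c *\<^sub>R X) \<cdot>\<^sub>6 Y = c * (X \<cdot>\<^sub>6 Y)"
  by (simp_all add: contr6_def sum.distrib sum_distrib_left algebra_simps)

lemma tr14_add: "tr14 (X + Y) = tr14 X + tr14 Y"
  by (simp add: tr14_def vec_eq_iff sum.distrib)

lemmas contr_linear = contr1_linear contr1_2_linear contr3_4_linear contr3_6_linear contr2_linear

lemma contr1_assoc: "X \<cdot>\<^sub>1 h \<cdot>\<^sub>1 Y = X \<cdot>\<^sub>1 (h \<cdot>\<^sub>1\<^sub>,\<^sub>2 Y)"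
  by (simp add: components contr1_def contr1_2_def algebra_simps)

lemma contr3_6_contr1: "Z \<cdot>\<^sub>3\<^sub>,\<^sub>6 (X \<cdot>\<^sub>1 Y) = Z \<cdot>\<^sub>3\<^sub>,\<^sub>6 X \<cdot>\<^sub>1 Y"
  by (simp add: components contr3_6_def contr1_def algebra_simps)

lemma contr3_4_contr1: "Z \<cdot>\<^sub>3\<^sub>,\<^sub>4 (X \<cdot>\<^sub>1 Y) = Z \<cdot>\<^sub>3\<^sub>,\<^sub>4 X \<cdot>\<^sub>1\<^sub>,\<^sub>2 Y"
  by (simp add: components contr3_4_def contr1_def contr1_2_def algebra_simps)

lemma contr1_contr3_6: "X \<cdot>\<^sub>1 Y \<cdot>\<^sub>3\<^sub>,\<^sub>6 Z = X \<cdot>\<^sub>1 (Y \<cdot>\<^sub>3\<^sub>,\<^sub>4 Z)"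
  by (simp add: components contr3_6_def contr3_4_def contr1_def algebra_simps)

lemma contr1_2_contr3_4: "h \<cdot>\<^sub>1\<^sub>,\<^sub>2 Y \<cdot>\<^sub>3\<^sub>,\<^sub>4 Z = h \<cdot>\<^sub>1\<^sub>,\<^sub>2 (Y \<cdot>\<^sub>3\<^sub>,\<^sub>4 Z)"
  by (simp add: components contr3_4_def contr1_2_def algebra_simps)

text \<open>Read left to right, these rules rebracket so that triple contractions act on the
  adjacent factor and known products such as those in \<open>Phi_Phi\<close> appear.\<close>

lemmas contr_assoc = contr1_assoc contr3_6_contr1 contr3_4_contr1 contr1_contr3_6 contr1_2_contr3_4

lemma contr3_4_assoc: "X \<cdot>\<^sub>3\<^sub>,\<^sub>4 Y \<cdot>\<^sub>3\<^sub>,\<^sub>4 Z = X \<cdot>\<^sub>3\<^sub>,\<^sub>4 (Y \<cdot>\<^sub>3\<^sub>,\<^sub>6 Z)"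
  by (simp add: components contr3_4_def contr3_6_def algebra_simps)

lemma contr3_6_assoc: "X \<cdot>\<^sub>3\<^sub>,\<^sub>6 Y \<cdot>\<^sub>3\<^sub>,\<^sub>6 Z = X \<cdot>\<^sub>3\<^sub>,\<^sub>6 (Y \<cdot>\<^sub>3\<^sub>,\<^sub>6 Z)"
  by (simp add: components contr3_6_def algebra_simps)

lemma id2_contr1_2: "id2 \<cdot>\<^sub>1\<^sub>,\<^sub>2 Y = Y"
  by (simp add: components contr1_2_def id2_def)

lemma contr1_2_id2: "h \<cdot>\<^sub>1\<^sub>,\<^sub>2 id2 = h"
  by (simp add: components contr1_2_def id2_def)

lemma contr1_id2: "X \<cdot>\<^sub>1 id2 = X"
  by (simp add: components contr1_def id2_def)

section \<open>Orthogonality of the projectors\<close>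

lemmas Phi_defs = Phi_s13_def Phi_r13_def Phi_s31_def Phi_r31_def transp31_def

text \<open>The two harmonic tensors of order 3 in the formula are orthogonal with squared norm 4.\<close>

lemma P33_eq:
  "P33 $ i $ j $ k $ l $ m $ n =
    (harmonic 1 0 (twos i + twos j + twos k) * harmonic 1 0 (twos l + twos m + twos n)
     + harmonic 0 1 (twos i + twos j + twos k) * harmonic 0 1 (twos l + twos m + twos n)) / 4"
proof -
  have "\<forall>i j k l m n. P33 $ i $ j $ k $ l $ m $ n =
    (harmonic 1 0 (twos i + twos j + twos k) * harmonic 1 0 (twos l + twos m + twos n)
     + harmonic 0 1 (twos i + twos j + twos k) * harmonic 0 1 (twos l + twos m + twos n)) / 4"
    by (simp add: components P33_def Id6_def P31s_def P31r_def contr1_def Phi_defs)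
  then show ?thesis by blast
qed

text \<open>Every term of the Phi tensors has a Kronecker delta on two of the three contracted
  indices, so the contraction takes traces of harmonic tensors.\<close>

lemma P33_Phi: "P33 \<cdot>\<^sub>3\<^sub>,\<^sub>6 \<Phi>s31 = 0" "P33 \<cdot>\<^sub>3\<^sub>,\<^sub>6 \<Phi>r31 = 0"
   "\<Phi>s13 \<cdot>\<^sub>3\<^sub>,\<^sub>4 P33 = 0" "\<Phi>r13 \<cdot>\<^sub>3\<^sub>,\<^sub>4 P33 = 0"
  by (simp_all add: components contr3_6_def contr3_4_def P33_eq Phi_defs)

lemma P33_idem: "P33 \<cdot>\<^sub>3\<^sub>,\<^sub>6 P33 = P33"
  by (simp add: components contr3_6_def P33_eq)

lemma P33_P33: "P33 \<cdot>\<^sub>6 P33 = 2"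
  by (simp add: components contr6_def P33_eq)

text \<open>The factors 3/4 and 2/3 are inverse to the constants in \<open>P31s\<close> and
  \<open>P31r\<close>.\<close>

lemma Phi_Phi:
   "\<Phi>s13 \<cdot>\<^sub>3\<^sub>,\<^sub>4 \<Phi>s31 = (3/4) *\<^sub>R id2" "\<Phi>r13 \<cdot>\<^sub>3\<^sub>,\<^sub>4 \<Phi>r31 = (2/3) *\<^sub>R id2"
   "\<Phi>s13 \<cdot>\<^sub>3\<^sub>,\<^sub>4 \<Phi>r31 = 0" "\<Phi>r13 \<cdot>\<^sub>3\<^sub>,\<^sub>4 \<Phi>s31 = 0"
  by (simp_all add: components contr3_4_def Phi_defs id2_def)

text \<open>The image of \<open>P33\<close> is harmonic in the first three indices; the parameters
  are the contractions of \<open>X\<close> with the two basis tensors of \<open>P33_eq\<close>,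
  divided by 4. Values in any real vector space cover orders 4 and 6 at once.\<close>

lemma P33_contr_eq:
  fixes X :: "'a::real_vector^2^2^2"
  shows "(P33 \<cdot>\<^sub>3\<^sub>,\<^sub>6 X) $ i $ j $ k =
    harmonic ((1/4) *\<^sub>R (X $ 1 $ 1 $ 1 - X $ 1 $ 2 $ 2 - X $ 2 $ 1 $ 2 - X $ 2 $ 2 $ 1))
      ((1/4) *\<^sub>R (X $ 1 $ 1 $ 2 + X $ 1 $ 2 $ 1 + X $ 2 $ 1 $ 1 - X $ 2 $ 2 $ 2))
      (twos i + twos j + twos k)"
proof -
  have "\<forall>i j k. (P33 \<cdot>\<^sub>3\<^sub>,\<^sub>6 X) $ i $ j $ k =
      harmonic ((1/4) *\<^sub>R (X $ 1 $ 1 $ 1 - X $ 1 $ 2 $ 2 - X $ 2 $ 1 $ 2 - X $ 2 $ 2 $ 1))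
      ((1/4) *\<^sub>R (X $ 1 $ 1 $ 2 + X $ 1 $ 2 $ 1 + X $ 2 $ 1 $ 1 - X $ 2 $ 2 $ 2))
      (twos i + twos j + twos k)"
    by (simp add: components contr3_6_def P33_eq algebra_simps)
  then show ?thesis by blast
qed

section \<open>Transposition\<close>

text \<open>For an order-6 tensor seen as a linear map on order-3 tensors, this is the
  adjoint.\<close>

definition swap63 :: "tensor6 \<Rightarrow> tensor6" where
  "swap63 A = (\<chi> i j k l m n. A $ l $ m $ n $ i $ j $ k)"

lemma swap63_P33: "swap63 P33 = P33"
  by (simp add: vec_eq_iff swap63_def P33_eq mult.commute)

lemma swap63_Ela6: "A \<in> Ela6 \<Longrightarrow> swap63 A = A"
  unfolding Ela6_def by (simp add: vec_eq_iff swap63_def)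

lemma swap63_contr3_6: "swap63 (X \<cdot>\<^sub>3\<^sub>,\<^sub>6 Y) = swap63 Y \<cdot>\<^sub>3\<^sub>,\<^sub>6 swap63 X"
  by (simp add: vec_eq_iff sum_2 swap63_def contr3_6_def mult.commute)

lemma transp31_contr3_6: "transp31 (X \<cdot>\<^sub>3\<^sub>,\<^sub>6 Y) = transp31 Y \<cdot>\<^sub>3\<^sub>,\<^sub>4 swap63 X"
  by (simp add: vec_eq_iff sum_2 swap63_def contr3_4_def contr3_6_def transp31_def mult.commute)

lemma transpose_contr3_4: "transpose (transp31 X \<cdot>\<^sub>3\<^sub>,\<^sub>4 Y) = transp31 Y \<cdot>\<^sub>3\<^sub>,\<^sub>4 X"
  by (simp add: vec_eq_iff sum_2 contr3_4_def transp31_def transpose_def mult.commute)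

lemma Id6_contr: "(Id6 \<cdot>\<^sub>3\<^sub>,\<^sub>6 X) $ i $ j $ k = (1/2) *\<^sub>R (X $ i $ j $ k + X $ j $ i $ k)"
proof -
  have "\<forall>i j k. (Id6 \<cdot>\<^sub>3\<^sub>,\<^sub>6 X) $ i $ j $ k = (1/2) *\<^sub>R (X $ i $ j $ k + X $ j $ i $ k)"
    by (simp add: components contr3_6_def Id6_def algebra_simps)
  then show ?thesis by blast
qed

lemma swap63_Id6: "swap63 Id6 = Id6"
  by (simp add: components swap63_def Id6_def)

lemma Id6_Ela6:
  assumes "A \<in> Ela6"
  shows "Id6 \<cdot>\<^sub>3\<^sub>,\<^sub>6 A = A" "A \<cdot>\<^sub>3\<^sub>,\<^sub>6 Id6 = A"
proof -
  show *: "Id6 \<cdot>\<^sub>3\<^sub>,\<^sub>6 A = A"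
    using assms unfolding Ela6_def by (simp add: vec_eq_iff Id6_contr)
  show "A \<cdot>\<^sub>3\<^sub>,\<^sub>6 Id6 = A"
    using swap63_contr3_6[of Id6 A] assms by (simp add: * swap63_Ela6 swap63_Id6)
qed

section \<open>Harmonic parts of the blocks\<close>

text \<open>The premise is harmonicity in the first three indices in fixed-point form: inserting
  \<open>P33\<close> next to the Phi tensor and reassociating gives zero.\<close>

lemma Phi13_harmonic:
  assumes "P33 \<cdot>\<^sub>3\<^sub>,\<^sub>6 X = X"
  shows "\<Phi>s13 \<cdot>\<^sub>3\<^sub>,\<^sub>4 X = 0" "\<Phi>r13 \<cdot>\<^sub>3\<^sub>,\<^sub>4 X = 0"
  using contr3_4_assoc[of \<Phi>s13 P33 X] contr3_4_assoc[of \<Phi>r13 P33 X]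
  by (simp_all add: assms P33_Phi contr3_4_linear)

lemma harmonic_Phi31_6:
  assumes "X \<cdot>\<^sub>3\<^sub>,\<^sub>6 P33 = X"
  shows "X \<cdot>\<^sub>3\<^sub>,\<^sub>6 \<Phi>s31 = 0" "X \<cdot>\<^sub>3\<^sub>,\<^sub>6 \<Phi>r31 = 0"
  using contr3_6_assoc[of X P33 \<Phi>s31] contr3_6_assoc[of X P33 \<Phi>r31]
  by (simp_all add: assms P33_Phi contr3_6_linear)

lemma harmonic_Phi31_4:
  assumes "X \<cdot>\<^sub>3\<^sub>,\<^sub>4 P33 = X"
  shows "X \<cdot>\<^sub>3\<^sub>,\<^sub>4 \<Phi>s31 = 0" "X \<cdot>\<^sub>3\<^sub>,\<^sub>4 \<Phi>r31 = 0"
  using contr3_4_assoc[of X P33 \<Phi>s31] contr3_4_assoc[of X P33 \<Phi>r31]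
  by (simp_all add: assms P33_Phi contr3_4_linear)

lemma K2_contr2:
  assumes "h \<in> K2"
  shows "h \<cdot>\<^sub>2 P22 = h" "h \<cdot>\<^sub>2 id2 = 0" "h \<cdot>\<^sub>2 \<epsilon> = 0"
proof -
  obtain x y where "\<And>i j. h $ i $ j = harmonic x y (twos i + twos j)"
    using assms unfolding K2_iff by blast
  then show "h \<cdot>\<^sub>2 P22 = h" "h \<cdot>\<^sub>2 id2 = 0" "h \<cdot>\<^sub>2 \<epsilon> = 0"
    by (simp_all add: components contr2_def P22_def id2_def levi_civita_def)
qed

lemma id2_contr2: "id2 \<cdot>\<^sub>2 P22 = 0" "id2 \<cdot>\<^sub>2 id2 = 2" "id2 \<cdot>\<^sub>2 \<epsilon> = 0"
  by (simp_all add: components contr2_def P22_def id2_def levi_civita_def)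

lemma levi_civita_contr2: "\<epsilon> \<cdot>\<^sub>2 P22 = 0" "\<epsilon> \<cdot>\<^sub>2 id2 = 0" "\<epsilon> \<cdot>\<^sub>2 \<epsilon> = 2"
  by (simp_all add: components contr2_def P22_def id2_def levi_civita_def)

lemma K2_P22: "a \<cdot>\<^sub>2 P22 \<in> K2"
proof -
  have "\<forall>i j. (a \<cdot>\<^sub>2 P22) $ i $ j =
      harmonic ((a $ 1 $ 1 - a $ 2 $ 2) / 2) ((a $ 1 $ 2 + a $ 2 $ 1) / 2) (twos i + twos j)"
    by (simp add: components contr2_def P22_def field_simps)
  then show ?thesis unfolding K2_iff by blast
qed

text \<open>Symmetric traceless, spherical and skew parts; the divisor 2 is the squared norm of
  \<open>id2\<close> and of \<epsilon>.\<close>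

lemma tensor2_split:
  "a = a \<cdot>\<^sub>2 P22 + ((a \<cdot>\<^sub>2 id2) / 2) *\<^sub>R id2 + ((a \<cdot>\<^sub>2 \<epsilon>) / 2) *\<^sub>R \<epsilon>"
  by (simp add: components contr2_def P22_def id2_def levi_civita_def field_simps)

lemma K4_contr:
  assumes "H \<in> K4"
  shows "P33 \<cdot>\<^sub>3\<^sub>,\<^sub>6 H = H" "H \<cdot>\<^sub>3\<^sub>,\<^sub>4 P33 = H" "tr14 H = 0" "transp31 H = H"
proof -
  obtain x y where "\<And>i j k l. H $ i $ j $ k $ l = harmonic x y (twos i + twos j + twos k + twos l)"
    using assms unfolding K4_iff by blast
  then show "P33 \<cdot>\<^sub>3\<^sub>,\<^sub>6 H = H" "H \<cdot>\<^sub>3\<^sub>,\<^sub>4 P33 = H" "tr14 H = 0" "transp31 H = H"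
    by (simp_all add: components contr3_6_def contr3_4_def P33_eq tr14_def transp31_def)
qed

text \<open>\<open>\<Phi>42\<close> is normalised so that \<open>tr14\<close> recovers
  \<open>h\<close>. Harmonicity holds in the first three indices, and transposition moves it to the
  last three.\<close>

lemma K2_Phi42:
  assumes "h \<in> K2"
  shows "P33 \<cdot>\<^sub>3\<^sub>,\<^sub>6 \<Phi>42 h = \<Phi>42 h" "transp31 (\<Phi>42 h) \<cdot>\<^sub>3\<^sub>,\<^sub>4 P33 = transp31 (\<Phi>42 h)" "tr14 (\<Phi>42 h) = h"
proof -
  obtain x y where "\<And>i j. h $ i $ j = harmonic x y (twos i + twos j)"
    using assms unfolding K2_iff by blast
  then show *: "P33 \<cdot>\<^sub>3\<^sub>,\<^sub>6 \<Phi>42 h = \<Phi>42 h" and "tr14 (\<Phi>42 h) = h"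
    by (simp_all add: components contr3_6_def P33_eq tr14_def Phi42_def field_simps)
  show "transp31 (\<Phi>42 h) \<cdot>\<^sub>3\<^sub>,\<^sub>4 P33 = transp31 (\<Phi>42 h)"
    using transp31_contr3_6[of P33 "\<Phi>42 h"] by (simp add: * swap63_P33)
qed

lemma K6_contr:
  assumes "H \<in> K6"
  shows "P33 \<cdot>\<^sub>3\<^sub>,\<^sub>6 H = H" "H \<cdot>\<^sub>3\<^sub>,\<^sub>6 P33 = H" "H \<cdot>\<^sub>6 P33 = 0"
proof -
  obtain x y where H: "\<And>i j k l m n. H $ i $ j $ k $ l $ m $ n =
      harmonic x y (twos i + twos j + twos k + twos l + twos m + twos n)"
    using assms unfolding K6_iff by blast
  then show "P33 \<cdot>\<^sub>3\<^sub>,\<^sub>6 H = H" "H \<cdot>\<^sub>3\<^sub>,\<^sub>6 P33 = H" "H \<cdot>\<^sub>6 P33 = 0"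
    by (simp_all add: components contr3_6_def contr6_def P33_eq)
qed

text \<open>Such an \<open>X\<close> is given by two vectors \<open>u\<close> and \<open>v\<close>,
  hence four numbers: two combinations form the trace, the complementary two the totally harmonic
  remainder.\<close>

lemma harmonic_tensor4_split:
  assumes "P33 \<cdot>\<^sub>3\<^sub>,\<^sub>6 X = X"
  shows "tr14 X \<in> K2" "X - \<Phi>42 (tr14 X) \<in> K4"
proof -
  obtain u v where X: "\<And>i j k. X $ i $ j $ k = harmonic u v (twos i + twos j + twos k)"
    using P33_contr_eq[of X] unfolding assms by blast
  have "\<forall>i j. tr14 X $ i $ j = harmonic (u $ 1 + v $ 2) (v $ 1 - u $ 2) (twos i + twos j)"
    by (simp add: components tr14_def X)
  then show "tr14 X \<in> K2" unfolding K2_iff by blast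
  have "\<forall>i j k l. (X - \<Phi>42 (tr14 X)) $ i $ j $ k $ l =
      harmonic ((u $ 1 - v $ 2) / 2) ((v $ 1 + u $ 2) / 2) (twos i + twos j + twos k + twos l)"
    by (simp add: components tr14_def X Phi42_def field_simps)
  then show "X - \<Phi>42 (tr14 X) \<in> K4" unfolding K4_iff by blast
qed

text \<open>\<open>B\<close> amounts to a symmetric 2x2 matrix with entries \<open>a\<close>,
  \<open>b\<close>, \<open>c\<close> on the harmonic order-3 tensors. Subtracting the multiple of
  \<open>P33\<close> removes its trace, and a traceless symmetric matrix gives an element of
  \<open>K6\<close>.\<close>

lemma harmonic_tensor6_split:
  assumes "P33 \<cdot>\<^sub>3\<^sub>,\<^sub>6 B = B" "swap63 B = B"
  shows "B - ((B \<cdot>\<^sub>6 P33) / 2) *\<^sub>R P33 \<in> K6"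
proof -
  obtain u v where uv: "\<And>i j k. B $ i $ j $ k = harmonic u v (twos i + twos j + twos k)"
    using P33_contr_eq[of B] unfolding assms by blast
  have swap: "B $ i $ j $ k $ l $ m $ n = B $ l $ m $ n $ i $ j $ k" for i j k l m n
    using arg_cong[OF assms(2), of "\<lambda>B. B $ l $ m $ n $ i $ j $ k"] by (simp add: swap63_def)
  define a b c where "a = u $ 1 $ 1 $ 1" and "b = u $ 1 $ 1 $ 2" and "c = v $ 1 $ 1 $ 2"
  have v: "v $ 1 $ 1 $ 1 = b"
    using swap[of 1 1 2 1 1 1] by (simp add: uv b_def)
  \<comment> \<open>Exchanging the index blocks turns harmonicity in the first three indices into
    harmonicity in the last three.\<close>
  have "u $ l $ m $ n = harmonic a b (twos l + twos m + twos n)"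
    "v $ l $ m $ n = harmonic b c (twos l + twos m + twos n)" for l m n
    using swap[of 1 1 1 l m n] swap[of 1 1 2 l m n]
    by (simp_all add: uv harmonic_nth v flip: a_def b_def c_def)
  then have B: "B $ i $ j $ k $ l $ m $ n = harmonic
      (harmonic a b (twos l + twos m + twos n)) (harmonic b c (twos l + twos m + twos n))
      (twos i + twos j + twos k)" for i j k l m n
    by (simp add: uv harmonic_nth)
  have "\<forall>i j k l m n. (B - ((B \<cdot>\<^sub>6 P33) / 2) *\<^sub>R P33) $ i $ j $ k $ l $ m $ n =
      harmonic ((a - c) / 2) b (twos i + twos j + twos k + twos l + twos m + twos n)"
    by (simp add: components contr6_def B P33_eq field_simps)
  then show ?thesis unfolding K6_iff by blast
qed

section \<open>The decomposition\<close>

text \<open>Orthogonality kills all other terms, and the constants cancel the factors of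
  \<open>Phi_Phi\<close>: for instance 16/9 * (3/4)^2 = 1 and 2 * 3/4 * 2/3 = 1.\<close>

lemma CGHD_blocks:
  assumes "is_CGHD A H33 H31s H31r h31s h31r h1s1r h1s1s h1r1r \<alpha>33 \<alpha>1s1s \<alpha>1r1r \<alpha>1s1r \<beta>1s1r"
  shows "A33 A = H33 + (\<alpha>33 / 2) *\<^sub>R P33"
    "a31s A = H31s + \<Phi>42 h31s"
    "a31r A = H31r + \<Phi>42 h31r"
    "a1s1s A = h1s1s + (\<alpha>1s1s / 2) *\<^sub>R id2"
    "a1r1r A = h1r1r + (\<alpha>1r1r / 2) *\<^sub>R id2"
    "a1s1r A = h1s1r + (\<alpha>1s1r / 2) *\<^sub>R id2 + (\<beta>1s1r / 2) *\<^sub>R \<epsilon>"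
proof -
  have mem: "H33 \<in> K6" "H31s \<in> K4" "H31r \<in> K4" "h31s \<in> K2" "h31r \<in> K2"
    using assms by (simp_all add: is_CGHD_def Let_def)
  note A = assms[unfolded is_CGHD_def Let_def, THEN conjunct2, THEN conjunct2, THEN conjunct2,
      THEN conjunct2, THEN conjunct2, THEN conjunct2, THEN conjunct2, THEN conjunct2]
  note harm = K6_contr[OF mem(1)] K4_contr[OF mem(2)] K4_contr[OF mem(3)]
    K2_Phi42[OF mem(4)] K2_Phi42[OF mem(5)]
  note rules = contr_linear contr_assoc P33_Phi P33_idem Phi_Phi P31s_def P31r_def
    id2_contr1_2 contr1_2_id2 contr1_id2 harm Phi13_harmonic harmonic_Phi31_6 harmonic_Phi31_4
  show "A33 A = H33 + (\<alpha>33 / 2) *\<^sub>R P33"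
    by (simp add: A33_def A rules)
  show "a31s A = H31s + \<Phi>42 h31s"
    by (simp add: a31s_def A rules)
  show "a31r A = H31r + \<Phi>42 h31r"
    by (simp add: a31r_def A rules)
  show "a1s1s A = h1s1s + (\<alpha>1s1s / 2) *\<^sub>R id2"
    by (simp add: a1s1s_def A rules)
  show "a1r1r A = h1r1r + (\<alpha>1r1r / 2) *\<^sub>R id2"
    by (simp add: a1r1r_def A rules)
  show "a1s1r A = h1s1r + (\<alpha>1s1r / 2) *\<^sub>R id2 + (\<beta>1s1r / 2) *\<^sub>R \<epsilon>"
    by (simp add: a1s1r_def A rules)
qed

text \<open>Each functional vanishes on the other harmonic parts of its block, and the squared norm
  2 of \<open>id2\<close>, \<epsilon> and \<open>P33\<close> cancels the halves.\<close>

lemma CGHD_extract: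
  assumes "is_CGHD A H33 H31s H31r h31s h31r h1s1r h1s1s h1r1r \<alpha>33 \<alpha>1s1s \<alpha>1r1r \<alpha>1s1r \<beta>1s1r"
  shows "\<beta>1s1r = a1s1r A \<cdot>\<^sub>2 \<epsilon> \<and>
    \<alpha>1s1r = a1s1r A \<cdot>\<^sub>2 id2 \<and>
    \<alpha>1r1r = a1r1r A \<cdot>\<^sub>2 id2 \<and>
    \<alpha>1s1s = a1s1s A \<cdot>\<^sub>2 id2 \<and>
    \<alpha>33 = A33 A \<cdot>\<^sub>6 P33 \<and>
    h1s1r = a1s1r A \<cdot>\<^sub>2 P22 \<and>
    h1r1r = a1r1r A \<cdot>\<^sub>2 P22 \<and>
    h1s1s = a1s1s A \<cdot>\<^sub>2 P22 \<and>
    h31r = tr14 (a31r A) \<and>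
    h31s = tr14 (a31s A) \<and>
    H31r = a31r A - \<Phi>42 h31r \<and>
    H31s = a31s A - \<Phi>42 h31s \<and>
    H33 = A33 A - (\<alpha>33 / 2) *\<^sub>R P33"
proof -
  have "H33 \<in> K6" "H31s \<in> K4" "H31r \<in> K4"
    "h31s \<in> K2" "h31r \<in> K2" "h1s1r \<in> K2" "h1s1s \<in> K2" "h1r1r \<in> K2"
    using assms by (simp_all add: is_CGHD_def Let_def)
  then show ?thesis
    by (simp add: CGHD_blocks[OF assms] contr_linear contr6_linear tr14_add K6_contr K4_contr
        K2_Phi42 K2_contr2 id2_contr2 levi_civita_contr2 P33_P33)
qed

lemma CGHD_exists:
  assumes "A \<in> Ela6"
  defines "h31s \<equiv> tr14 (a31s A)" and "h31r \<equiv> tr14 (a31r A)"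
    and "\<alpha>33 \<equiv> A33 A \<cdot>\<^sub>6 P33"
  shows "is_CGHD A (A33 A - (\<alpha>33 / 2) *\<^sub>R P33) (a31s A - \<Phi>42 h31s) (a31r A - \<Phi>42 h31r) h31s h31r
    (a1s1r A \<cdot>\<^sub>2 P22) (a1s1s A \<cdot>\<^sub>2 P22) (a1r1r A \<cdot>\<^sub>2 P22)
    \<alpha>33 (a1s1s A \<cdot>\<^sub>2 id2) (a1r1r A \<cdot>\<^sub>2 id2) (a1s1r A \<cdot>\<^sub>2 id2) (a1s1r A \<cdot>\<^sub>2 \<epsilon>)"
proof -
  define H33 where "H33 = A33 A - (\<alpha>33 / 2) *\<^sub>R P33"
  define H31s where "H31s = a31s A - \<Phi>42 h31s"
  define H31r where "H31r = a31r A - \<Phi>42 h31r"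
  note swap = swap63_Ela6[OF assms(1)]
  have P33_A33: "P33 \<cdot>\<^sub>3\<^sub>,\<^sub>6 A33 A = A33 A" and P33_a31: "P33 \<cdot>\<^sub>3\<^sub>,\<^sub>6 a31s A = a31s A" "P33 \<cdot>\<^sub>3\<^sub>,\<^sub>6 a31r A = a31r A"
    by (simp_all add: A33_def a31s_def a31r_def P33_idem flip: contr3_6_assoc)
  have swap_A33: "swap63 (A33 A) = A33 A"
    by (simp add: A33_def swap63_contr3_6 swap63_P33 swap contr3_6_assoc)
  have mem: "H33 \<in> K6" "H31s \<in> K4" "H31r \<in> K4" "h31s \<in> K2" "h31r \<in> K2"
    using harmonic_tensor6_split[OF P33_A33 swap_A33] harmonic_tensor4_split[OF P33_a31(1)]
      harmonic_tensor4_split[OF P33_a31(2)]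
    by (simp_all add: H33_def H31s_def H31r_def h31s_def h31r_def \<alpha>33_def)
  \<comment> \<open>The block symmetry of \<open>A\<close> pairs each block with the one having its
    two outer factors interchanged.\<close>
  have transpose_block: "transpose (transp31 X \<cdot>\<^sub>3\<^sub>,\<^sub>4 A \<cdot>\<^sub>3\<^sub>,\<^sub>4 Y) = transp31 Y \<cdot>\<^sub>3\<^sub>,\<^sub>4 A \<cdot>\<^sub>3\<^sub>,\<^sub>4 X" for X Y :: tensor4
    by (simp add: contr3_4_assoc transpose_contr3_4 transp31_contr3_6 swap)
  have transp_block: "transp31 X \<cdot>\<^sub>3\<^sub>,\<^sub>4 A \<cdot>\<^sub>3\<^sub>,\<^sub>4 P33 = transp31 (P33 \<cdot>\<^sub>3\<^sub>,\<^sub>6 A \<cdot>\<^sub>3\<^sub>,\<^sub>6 X)" for X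
    by (simp add: contr3_4_assoc transp31_contr3_6 swap63_contr3_6 swap63_P33 swap)
  have A33: "P33 \<cdot>\<^sub>3\<^sub>,\<^sub>6 A \<cdot>\<^sub>3\<^sub>,\<^sub>6 P33 = H33 + (\<alpha>33 / 2) *\<^sub>R P33"
    by (simp add: A33_def H33_def)
  have a31: "P33 \<cdot>\<^sub>3\<^sub>,\<^sub>6 A \<cdot>\<^sub>3\<^sub>,\<^sub>6 \<Phi>s31 = H31s + \<Phi>42 h31s" "P33 \<cdot>\<^sub>3\<^sub>,\<^sub>6 A \<cdot>\<^sub>3\<^sub>,\<^sub>6 \<Phi>r31 = H31r + \<Phi>42 h31r"
    by (simp_all add: a31s_def H31s_def a31r_def H31r_def)
  have transp31_add: "transp31 (X + Y) = transp31 X + transp31 Y" for X Y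
    by (simp add: transp31_def vec_eq_iff)
  \<comment> \<open>The \<open>K4\<close> parts are invariant under \<open>transp31\<close>, so only
    the \<open>\<Phi>42\<close> parts show a transpose.\<close>
  have a13: "\<Phi>s13 \<cdot>\<^sub>3\<^sub>,\<^sub>4 A \<cdot>\<^sub>3\<^sub>,\<^sub>4 P33 = H31s + transp31 (\<Phi>42 h31s)"
    "\<Phi>r13 \<cdot>\<^sub>3\<^sub>,\<^sub>4 A \<cdot>\<^sub>3\<^sub>,\<^sub>4 P33 = H31r + transp31 (\<Phi>42 h31r)"
    by (simp_all add: Phi_s13_def Phi_r13_def transp_block a31 transp31_add K4_contr mem)
  \<comment> \<open>The two diagonal vector blocks are symmetric, so they carry no
    pseudo-scalar.\<close>
  have skew: "a \<cdot>\<^sub>2 \<epsilon> = 0" if "transpose a = a" for a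
    using arg_cong[OF that, of "\<lambda>a. a $ 1 $ 2"]
    by (simp add: components contr2_def levi_civita_def transpose_def)
  have sym: "a1s1s A \<cdot>\<^sub>2 \<epsilon> = 0" "a1r1r A \<cdot>\<^sub>2 \<epsilon> = 0"
    using transpose_block by (auto intro!: skew simp: a1s1s_def a1r1r_def Phi_s13_def Phi_r13_def)
  have a11: "\<Phi>s13 \<cdot>\<^sub>3\<^sub>,\<^sub>4 A \<cdot>\<^sub>3\<^sub>,\<^sub>4 \<Phi>s31 = a1s1s A \<cdot>\<^sub>2 P22 + ((a1s1s A \<cdot>\<^sub>2 id2) / 2) *\<^sub>R id2"
    "\<Phi>r13 \<cdot>\<^sub>3\<^sub>,\<^sub>4 A \<cdot>\<^sub>3\<^sub>,\<^sub>4 \<Phi>r31 = a1r1r A \<cdot>\<^sub>2 P22 + ((a1r1r A \<cdot>\<^sub>2 id2) / 2) *\<^sub>R id2"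
    "\<Phi>s13 \<cdot>\<^sub>3\<^sub>,\<^sub>4 A \<cdot>\<^sub>3\<^sub>,\<^sub>4 \<Phi>r31 =
      a1s1r A \<cdot>\<^sub>2 P22 + ((a1s1r A \<cdot>\<^sub>2 id2) / 2) *\<^sub>R id2 + ((a1s1r A \<cdot>\<^sub>2 \<epsilon>) / 2) *\<^sub>R \<epsilon>"
    using tensor2_split[of "a1s1s A"] tensor2_split[of "a1r1r A"] tensor2_split[of "a1s1r A"]
    by (simp_all add: sym flip: a1s1s_def a1r1r_def a1s1r_def)
  \<comment> \<open>Transposition reverses only the skew part; this is the source of the minus sign
    in the \<epsilon> term of the decomposition.\<close>
  have transpose_split: "transpose a =
      a \<cdot>\<^sub>2 P22 + ((a \<cdot>\<^sub>2 id2) / 2) *\<^sub>R id2 - ((a \<cdot>\<^sub>2 \<epsilon>) / 2) *\<^sub>R \<epsilon>" for a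
    by (simp add: components contr2_def P22_def id2_def levi_civita_def transpose_def field_simps)
  have a1r1s: "\<Phi>r13 \<cdot>\<^sub>3\<^sub>,\<^sub>4 A \<cdot>\<^sub>3\<^sub>,\<^sub>4 \<Phi>s31 =
      a1s1r A \<cdot>\<^sub>2 P22 + ((a1s1r A \<cdot>\<^sub>2 id2) / 2) *\<^sub>R id2 - ((a1s1r A \<cdot>\<^sub>2 \<epsilon>) / 2) *\<^sub>R \<epsilon>"
    using transpose_split[of "a1s1r A"] transpose_block[of \<Phi>s31 \<Phi>r31]
    by (simp add: a1s1r_def Phi_s13_def Phi_r13_def)
  have "Id6 = P33 + P31s + P31r"
    by (simp add: P33_def)
  then have "A = (P33 + P31s + P31r) \<cdot>\<^sub>3\<^sub>,\<^sub>6 A \<cdot>\<^sub>3\<^sub>,\<^sub>6 (P33 + P31s + P31r)"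
    using Id6_Ela6[OF assms(1)] by simp
  \<comment> \<open>The nine blocks, with coefficients 16/9 = (4/3)^2, 9/4 = (3/2)^2 and 2 = 4/3 *
    3/2.\<close>
  also have "\<dots> = P33 \<cdot>\<^sub>3\<^sub>,\<^sub>6 A \<cdot>\<^sub>3\<^sub>,\<^sub>6 P33
    + (4/3) *\<^sub>R (P33 \<cdot>\<^sub>3\<^sub>,\<^sub>6 A \<cdot>\<^sub>3\<^sub>,\<^sub>6 \<Phi>s31 \<cdot>\<^sub>1 \<Phi>s13 + \<Phi>s31 \<cdot>\<^sub>1 (\<Phi>s13 \<cdot>\<^sub>3\<^sub>,\<^sub>4 A \<cdot>\<^sub>3\<^sub>,\<^sub>4 P33))
    + (3/2) *\<^sub>R (P33 \<cdot>\<^sub>3\<^sub>,\<^sub>6 A \<cdot>\<^sub>3\<^sub>,\<^sub>6 \<Phi>r31 \<cdot>\<^sub>1 \<Phi>r13 + \<Phi>r31 \<cdot>\<^sub>1 (\<Phi>r13 \<cdot>\<^sub>3\<^sub>,\<^sub>4 A \<cdot>\<^sub>3\<^sub>,\<^sub>4 P33))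
    + (16/9) *\<^sub>R (\<Phi>s31 \<cdot>\<^sub>1 (\<Phi>s13 \<cdot>\<^sub>3\<^sub>,\<^sub>4 A \<cdot>\<^sub>3\<^sub>,\<^sub>4 \<Phi>s31 \<cdot>\<^sub>1\<^sub>,\<^sub>2 \<Phi>s13))
    + (9/4) *\<^sub>R (\<Phi>r31 \<cdot>\<^sub>1 (\<Phi>r13 \<cdot>\<^sub>3\<^sub>,\<^sub>4 A \<cdot>\<^sub>3\<^sub>,\<^sub>4 \<Phi>r31 \<cdot>\<^sub>1\<^sub>,\<^sub>2 \<Phi>r13))
    + 2 *\<^sub>R (\<Phi>s31 \<cdot>\<^sub>1 (\<Phi>s13 \<cdot>\<^sub>3\<^sub>,\<^sub>4 A \<cdot>\<^sub>3\<^sub>,\<^sub>4 \<Phi>r31 \<cdot>\<^sub>1\<^sub>,\<^sub>2 \<Phi>r13)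
      + \<Phi>r31 \<cdot>\<^sub>1 (\<Phi>r13 \<cdot>\<^sub>3\<^sub>,\<^sub>4 A \<cdot>\<^sub>3\<^sub>,\<^sub>4 \<Phi>s31 \<cdot>\<^sub>1\<^sub>,\<^sub>2 \<Phi>s13))"
    by (simp add: P31s_def P31r_def contr_linear contr_assoc algebra_simps)
  finally have A: "A = \<dots>" .
  show ?thesis
    unfolding is_CGHD_def Let_def H33_def[symmetric] H31s_def[symmetric] H31r_def[symmetric]
    \<comment> \<open>Transitivity replaces only the left-hand \<open>A\<close>; the blocks on the
      right still contain \<open>A\<close>, so rewriting with this equation would loop.\<close>
    by (intro conjI mem K2_P22 trans[OF A])
      (simp add: A33 a31 a13 a11 a1r1s contr_linear contr1_assoc id2_contr1_2 P31s_def P31r_def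
        algebra_simps)
qed

theorem proposition5p9:
  fixes A :: tensor6
  assumes "A \<in> Ela6"
  shows "(\<exists>!(H33, H31s, H31r, h31s, h31r, h1s1r, h1s1s, h1r1r, \<alpha>33, \<alpha>1s1s, \<alpha>1r1r, \<alpha>1s1r, \<beta>1s1r).
            is_CGHD A H33 H31s H31r h31s h31r h1s1r h1s1s h1r1r \<alpha>33 \<alpha>1s1s \<alpha>1r1r \<alpha>1s1r \<beta>1s1r) \<and>
         (\<forall>H33 H31s H31r h31s h31r h1s1r h1s1s h1r1r \<alpha>33 \<alpha>1s1s \<alpha>1r1r \<alpha>1s1r \<beta>1s1r.
            is_CGHD A H33 H31s H31r h31s h31r h1s1r h1s1s h1r1r \<alpha>33 \<alpha>1s1s \<alpha>1r1r \<alpha>1s1r \<beta>1s1r \<longrightarrow>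
              \<beta>1s1r = a1s1r A \<cdot>\<^sub>2 \<epsilon> \<and>
              \<alpha>1s1r = a1s1r A \<cdot>\<^sub>2 id2 \<and>
              \<alpha>1r1r = a1r1r A \<cdot>\<^sub>2 id2 \<and>
              \<alpha>1s1s = a1s1s A \<cdot>\<^sub>2 id2 \<and>
              \<alpha>33 = A33 A \<cdot>\<^sub>6 P33 \<and>
              h1s1r = a1s1r A \<cdot>\<^sub>2 P22 \<and>
              h1r1r = a1r1r A \<cdot>\<^sub>2 P22 \<and>
              h1s1s = a1s1s A \<cdot>\<^sub>2 P22 \<and>
              h31r = tr14 (a31r A) \<and>
              h31s = tr14 (a31s A) \<and>
              H31r = a31r A - \<Phi>42 h31r \<and>
              H31s = a31s A - \<Phi>42 h31s \<and>
              H33 = A33 A - (\<alpha>33 / 2) *\<^sub>R P33)"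
proof (rule conjI)
  show "\<exists>!(H33, H31s, H31r, h31s, h31r, h1s1r, h1s1s, h1r1r, \<alpha>33, \<alpha>1s1s, \<alpha>1r1r, \<alpha>1s1r, \<beta>1s1r).
      is_CGHD A H33 H31s H31r h31s h31r h1s1r h1s1s h1r1r \<alpha>33 \<alpha>1s1s \<alpha>1r1r \<alpha>1s1r \<beta>1s1r"
    \<comment> \<open>The witnesses come from \<open>CGHD_exists\<close>; by
      \<open>CGHD_extract\<close> any other family is determined by \<open>A\<close> and coincides
      with them.\<close>
    using CGHD_exists[OF assms]
    by (intro ex1I[of _ "(_, _, _, _, _, _, _, _, _, _, _, _, _)"])
      (simp, clarify, drule CGHD_extract, simp)
qed (use CGHD_extract in blast)

end
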